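(* Let $\beta_1,\dots,\beta_k\in\mathbb R^n\setminus\{0\}$ be a set of generators of the vector space $\mathbb R^n$, and let $\|\cdot\|$ be the norm $$\|v\|:=\sum_{i=1}^k|\langle\beta_i,v\rangle|.$$ Then $\|\cdot\|$ has polyhedral unit ball, the linear cellular decomposition of $S^{n-1}$ induced by $\|\cdot\|$ is complete, and its $(n-2)$-skeleton is $$\mathcal F^{n-2}(\|\cdot\|)=S^{n-1}\cap\Big(\bigcup_{i=1}^k\beta_i^{\perp}\Big).$$
   Context: Let $P\subset\mathbb R^n$ be a convex (solid) polyhedron containing the origin in its interior, and let $\pi:\mathbb R^n\setminus\{0\}\to S^{n-1}$ be the radial projection. The decomposition of $\partial P$ into its open faces induces via $\pi$ a cellular decomposition $\mathcal F(P)$ of $S^{n-1}$, whose cells are the sets $\pi(F)$ for $F$ an open face of $\partial P$; it is called a linear cellular decomposition. $\mathcal F^k(P)$ denotes its $k$-skeleton. There always exist $\beta_1,\dots,\beta_k\in\mathbb R^n\setminus\{0\}$ with $\mathcal F^{n-2}(P)\subset S^{n-1}\cap(\bigcup_i\beta_i^\perp)$, where $\beta_i^\perp$ is the orthogonal hyperplane of $\beta_i$ for the standard scalar product $\langle\cdot,\cdot\rangle$. If such $\beta_i$ can be found with this inclusion being an equality, the linear cellular decomposition (and the polyhedron $P$) is called complete. If $\|\cdot\|$ is a norm on $\mathbb R^n$ whose unit ball is a polyhedron $P$, then $\mathcal F(\|\cdot\|):=\mathcal F(P)$ and $\mathcal F^k(\|\cdot\|):=\mathcal F^k(P)$. *)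

theory Defs
  imports "HOL-Analysis.Analysis"
begin

definition is_norm :: "('a::real_vector \<Rightarrow> real) \<Rightarrow> bool" where
  "is_norm N \<longleftrightarrow>
     (\<forall>v. 0 \<le> N v) \<and> (\<forall>v. N v = 0 \<longleftrightarrow> v = 0) \<and>
     (\<forall>a v. N (a *\<^sub>R v) = \<bar>a\<bar> * N v) \<and> (\<forall>v w. N (v + w) \<le> N v + N w)"

definition unit_ball :: "('a \<Rightarrow> real) \<Rightarrow> 'a set" where
  "unit_ball N = {v. N v \<le> 1}"

text \<open>Boundedness is required because the radial projections of the proper faces of \<open>P\<close>
  cover the sphere only if \<open>P\<close> is bounded. For the unit ball of a norm it is automatic.\<close>

definition solid_polyhedron :: "(real ^ 'n) set \<Rightarrow> bool" where
  "solid_polyhedron P \<longleftrightarrow> polyhedron P \<and> bounded P \<and> 0 \<in> interior P"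

definition has_polyhedral_unit_ball :: "(real ^ 'n \<Rightarrow> real) \<Rightarrow> bool" where
  "has_polyhedral_unit_ball N \<longleftrightarrow> is_norm N \<and> solid_polyhedron (unit_ball N)"

definition radial_proj :: "real ^ 'n \<Rightarrow> real ^ 'n" where
  "radial_proj x = x /\<^sub>R norm x"

text \<open>The library counts \<open>{}\<close> and \<open>P\<close> itself among the faces of \<open>P\<close>; neither is a face of
  the boundary.\<close>

definition open_boundary_faces :: "(real ^ 'n) set \<Rightarrow> (real ^ 'n) set set" where
  "open_boundary_faces P = {rel_interior F | F. F face_of P \<and> F \<noteq> {} \<and> F \<noteq> P}"

text \<open>A linear cellular decomposition is encoded as the family, indexed by the dimension
  \<open>d\<close>, of its sets of open \<open>d\<close>-cells. The cell \<open>\<pi>(F)\<close> has the dimension of \<open>F\<close>, because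
  \<open>\<pi>\<close> restricts to a homeomorphism from the boundary of \<open>P\<close> to the sphere. Dimensions are
  integers, so that the \<open>(n - 2)\<close>-skeleton is empty (and not the \<open>0\<close>-skeleton) for \<open>n = 1\<close>.\<close>

definition linear_decomposition :: "(real ^ 'n) set \<Rightarrow> int \<Rightarrow> (real ^ 'n) set set" where
  "linear_decomposition P d =
     {radial_proj ` F | F. F \<in> open_boundary_faces P \<and> aff_dim F = d}"

definition skeleton :: "(int \<Rightarrow> 'a set set) \<Rightarrow> int \<Rightarrow> 'a set" where
  "skeleton D k = (\<Union>d\<in>{..k}. \<Union>(D d))"

definition complete_linear_decomposition :: "(int \<Rightarrow> (real ^ 'n) set set) \<Rightarrow> bool" where
  "complete_linear_decomposition D \<longleftrightarrow>
     (\<exists>P. solid_polyhedron P \<and> D = linear_decomposition P) \<and>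
     (\<exists>B. finite B \<and> 0 \<notin> B \<and>
        skeleton D (int CARD('n) - 2) = sphere 0 1 \<inter> (\<Union>b\<in>B. {x. b \<bullet> x = 0}))"

definition norm_decomposition :: "(real ^ 'n \<Rightarrow> real) \<Rightarrow> int \<Rightarrow> (real ^ 'n) set set" where
  "norm_decomposition N = linear_decomposition (unit_ball N)"

end

theory Submission
  imports Defs
begin

text \<open>If \<open>N y = 1\<close>, let \<open>b\<close> be the sum of the \<open>sgn (\<beta> i \<bullet> y) \<beta> i\<close>. Then \<open>b \<bullet> v \<le> N v\<close> for
  all \<open>v\<close>, so \<open>b \<bullet> v = 1\<close> cuts out of the unit ball a face, whose affine hull is defined
  by \<open>b \<bullet> v = 1\<close> and the equations \<open>\<beta> i \<bullet> v = 0\<close> for those \<open>i\<close> with \<open>\<beta> i \<bullet> y = 0\<close>. The other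
  conditions on the face are weak sign conditions that hold strictly at \<open>y\<close>, so \<open>y\<close> is a relative
  interior point, and this is the only face containing \<open>y\<close> in its relative interior. Its dimension is \<open>n - 1\<close> if
  no \<open>\<beta> i \<bullet> y\<close> vanishes. Otherwise its affine hull is a proper subset of some hyperplane
  \<open>\<beta> i \<bullet> v = 0\<close>, as it misses the origin.\<close>

locale generating_family =
  fixes I :: "'i set" and \<beta> :: "'i \<Rightarrow> 'a::euclidean_space"
  assumes finite_index: "finite I"
    and nonzero: "i \<in> I \<Longrightarrow> \<beta> i \<noteq> 0"
    and span_UNIV: "span (\<beta> ` I) = UNIV"
begin

definition abs_sum :: "'a \<Rightarrow> real" where
  "abs_sum v = (\<Sum>i\<in>I. \<bar>\<beta> i \<bullet> v\<bar>)"

text \<open>A subgradient of \<open>abs_sum\<close> at \<open>y\<close>. Since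
  \<open>sgn 0 = 0\<close>, the generators orthogonal to \<open>y\<close> drop out.\<close>

definition signed_sum :: "'a \<Rightarrow> 'a" where
  "signed_sum y = (\<Sum>i\<in>I. sgn (\<beta> i \<bullet> y) *\<^sub>R \<beta> i)"

definition sign_face :: "'a \<Rightarrow> 'a set" where
  "sign_face y = unit_ball abs_sum \<inter> {v. signed_sum y \<bullet> v = 1}"

definition sign_flat :: "'a \<Rightarrow> 'a set" where
  "sign_flat y = {v. signed_sum y \<bullet> v = 1} \<inter> (\<Inter>i\<in>{i\<in>I. \<beta> i \<bullet> y = 0}. {v. \<beta> i \<bullet> v = 0})"

text \<open>The inequalities are strict and finite in number, which makes this an open neighbourhood
  of \<open>y\<close>.\<close>

definition sign_cone :: "'a \<Rightarrow> 'a set" where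
  "sign_cone y = (\<Inter>i\<in>{i\<in>I. \<beta> i \<bullet> y \<noteq> 0}. {v. 0 < (sgn (\<beta> i \<bullet> y) *\<^sub>R \<beta> i) \<bullet> v})"

section \<open>The norm and its polyhedral unit ball\<close>

lemma abs_sum_nonneg: "0 \<le> abs_sum v"
  by (simp add: abs_sum_def sum_nonneg)

lemma abs_sum_eq_0_iff: "abs_sum v = 0 \<longleftrightarrow> v = 0"
proof
  assume "abs_sum v = 0"
  then have "\<forall>i\<in>I. \<beta> i \<bullet> v = 0"
    using finite_index by (simp add: abs_sum_def sum_nonneg_eq_0_iff)
  \<comment> \<open>Being orthogonal to all generators, \<open>v\<close> is orthogonal to their
    span, which contains \<open>v\<close>.\<close>
  then have "orthogonal v v"
    by (intro orthogonal_to_span[of v "\<beta> ` I"]) (auto simp: span_UNIV orthogonal_def inner_commute)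
  then show "v = 0"
    by (simp add: orthogonal_def)
qed (simp add: abs_sum_def)

lemma abs_sum_scaleR: "abs_sum (a *\<^sub>R v) = \<bar>a\<bar> * abs_sum v"
  by (simp add: abs_sum_def abs_mult sum_distrib_left)

lemma is_norm_abs_sum: "is_norm abs_sum"
proof -
  have "abs_sum (v + w) \<le> abs_sum v + abs_sum w" for v w
    unfolding abs_sum_def sum.distrib[symmetric]
    by (intro sum_mono) (simp add: inner_add_right)
  then show ?thesis
    by (simp add: is_norm_def abs_sum_nonneg abs_sum_eq_0_iff abs_sum_scaleR)
qed

lemma continuous_on_abs_sum: "continuous_on S abs_sum"
  unfolding abs_sum_def by (intro continuous_intros)

lemma open_abs_sum_less: "open {v. abs_sum v < 1}"
  by (intro open_Collect_less continuous_on_abs_sum continuous_intros)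

lemma abs_sum_less_interior: "abs_sum v < 1 \<Longrightarrow> v \<in> interior (unit_ball abs_sum)"
  using open_abs_sum_less by (rule interiorI) (auto simp: unit_ball_def)

lemma zero_in_interior_unit_ball: "0 \<in> interior (unit_ball abs_sum)"
  by (rule abs_sum_less_interior) (simp add: abs_sum_def)

text \<open>By compactness \<open>abs_sum\<close> attains a minimum on the Euclidean sphere,
  positive by definiteness. By homogeneity its reciprocal bounds the ball.\<close>

lemma bounded_unit_ball_abs_sum: "bounded (unit_ball abs_sum)"
proof -
  obtain u where u: "u \<in> sphere 0 1" and le: "\<And>w. w \<in> sphere 0 1 \<Longrightarrow> abs_sum u \<le> abs_sum w"
    using continuous_attains_inf[OF _ _ continuous_on_abs_sum, of "sphere 0 1"] by auto
  have pos: "0 < abs_sum u"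
    using u abs_sum_nonneg[of u] abs_sum_eq_0_iff[of u] by fastforce
  have "norm v \<le> 1 / abs_sum u" if "v \<in> unit_ball abs_sum" for v
  proof (cases "v = 0")
    case False
    then have "abs_sum u \<le> abs_sum (v /\<^sub>R norm v)"
      by (intro le) simp
    also have "\<dots> \<le> 1 / norm v"
      using that False by (simp add: abs_sum_scaleR unit_ball_def divide_simps)
    finally show ?thesis
      using False pos by (simp add: field_simps)
  qed (use pos in simp)
  then show ?thesis
    by (auto simp: bounded_iff)
qed

text \<open>The norm is the maximum of finitely many linear forms \<open>c A\<close>, one for each
  choice of signs, with \<open>A\<close> the set of indices that get a plus. So the ball is a finite
  intersection of half-spaces.\<close>

lemma polyhedron_unit_ball_abs_sum: "polyhedron (unit_ball abs_sum)"
proof -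
  define c where "c A = (\<Sum>i\<in>I. (if i \<in> A then 1 else - 1) *\<^sub>R \<beta> i)" for A
  have c_inner: "c A \<bullet> v = (\<Sum>i\<in>I. (if i \<in> A then 1 else - 1) * (\<beta> i \<bullet> v))" for A v
    by (simp add: c_def inner_sum_left)
  have le: "c A \<bullet> v \<le> abs_sum v" for A v
    unfolding c_inner abs_sum_def by (intro sum_mono) auto
  have eq: "c {i\<in>I. 0 \<le> \<beta> i \<bullet> v} \<bullet> v = abs_sum v" for v
    unfolding c_inner abs_sum_def by (intro sum.cong) auto
  have "unit_ball abs_sum = (\<Inter>A\<in>Pow I. {v. c A \<bullet> v \<le> 1})"
  proof (intro equalityI subsetI)
    fix v assume "v \<in> unit_ball abs_sum"
    then show "v \<in> (\<Inter>A\<in>Pow I. {v. c A \<bullet> v \<le> 1})"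
      using order_trans[OF le] by (auto simp: unit_ball_def)
  next
    fix v assume "v \<in> (\<Inter>A\<in>Pow I. {v. c A \<bullet> v \<le> 1})"
    then have "c {i\<in>I. 0 \<le> \<beta> i \<bullet> v} \<bullet> v \<le> 1"
      by blast
    then show "v \<in> unit_ball abs_sum"
      by (simp add: eq unit_ball_def)
  qed
  then show ?thesis
    using finite_index by (auto intro!: polyhedron_Inter polyhedron_halfspace_le)
qed

lemma convex_unit_ball_abs_sum: "convex (unit_ball abs_sum)"
  by (rule polyhedron_imp_convex[OF polyhedron_unit_ball_abs_sum])

section \<open>Faces cut out by sign patterns\<close>

lemma signed_sum_inner: "signed_sum y \<bullet> v = (\<Sum>i\<in>I. sgn (\<beta> i \<bullet> y) * (\<beta> i \<bullet> v))"
  by (simp add: signed_sum_def inner_sum_left)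

lemma sgn_mult_le_abs: "sgn (s::real) * t \<le> \<bar>t\<bar>"
  using abs_ge_self[of t] abs_ge_minus_self[of t] by (simp add: sgn_if)

lemma signed_sum_inner_le: "signed_sum y \<bullet> v \<le> abs_sum v"
  unfolding signed_sum_inner abs_sum_def by (intro sum_mono sgn_mult_le_abs)

lemma signed_sum_inner_self: "signed_sum y \<bullet> y = abs_sum y"
  unfolding signed_sum_inner abs_sum_def by (intro sum.cong) (auto simp: sgn_if)

text \<open>The inequality between the two sums holds term by term, so equality of the sums forces
  equality in each term.\<close>

lemma signed_sum_inner_eq_iff:
  "signed_sum y \<bullet> v = abs_sum v \<longleftrightarrow> (\<forall>i\<in>I. sgn (\<beta> i \<bullet> y) * (\<beta> i \<bullet> v) = \<bar>\<beta> i \<bullet> v\<bar>)"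
proof -
  have "signed_sum y \<bullet> v = abs_sum v \<longleftrightarrow>
      (\<Sum>i\<in>I. \<bar>\<beta> i \<bullet> v\<bar> - sgn (\<beta> i \<bullet> y) * (\<beta> i \<bullet> v)) = 0"
    by (auto simp: signed_sum_inner abs_sum_def sum_subtractf)
  also have "\<dots> \<longleftrightarrow> (\<forall>i\<in>I. \<bar>\<beta> i \<bullet> v\<bar> - sgn (\<beta> i \<bullet> y) * (\<beta> i \<bullet> v) = 0)"
    using finite_index sgn_mult_le_abs by (intro sum_nonneg_eq_0_iff) simp_all
  finally show ?thesis
    by auto
qed

lemma sign_face_face_of: "sign_face y face_of unit_ball abs_sum"
  unfolding sign_face_def
proof (rule face_of_Int_supporting_hyperplane_le[OF convex_unit_ball_abs_sum])
  show "signed_sum y \<bullet> v \<le> 1" if "v \<in> unit_ball abs_sum" for v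
    using that signed_sum_inner_le[of y v] by (simp add: unit_ball_def)
qed

lemma sign_face_neq_unit_ball: "sign_face y \<noteq> unit_ball abs_sum"
proof -
  have "0 \<notin> sign_face y" "0 \<in> unit_ball abs_sum"
    by (auto simp: sign_face_def unit_ball_def abs_sum_def)
  then show ?thesis
    by blast
qed

lemma mem_sign_face: "abs_sum y = 1 \<Longrightarrow> y \<in> sign_face y"
  by (simp add: sign_face_def unit_ball_def signed_sum_inner_self)

text \<open>On the face, \<open>signed_sum y\<close> attains the bound \<open>abs_sum v\<close>. A
  term with \<open>\<beta> i \<bullet> y = 0\<close> then reads
  \<open>0 = \<bar>\<beta> i \<bullet> v\<bar>\<close>.\<close>

lemma sign_face_subset_sign_flat: "sign_face y \<subseteq> sign_flat y"
proof
  fix v assume v: "v \<in> sign_face y"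
  then have "signed_sum y \<bullet> v = abs_sum v"
    using signed_sum_inner_le[of y v] by (simp add: sign_face_def unit_ball_def)
  then show "v \<in> sign_flat y"
    using v unfolding signed_sum_inner_eq_iff by (force simp: sign_flat_def sign_face_def)
qed

text \<open>Each \<open>\<beta> i \<bullet> v\<close> has the sign of
  \<open>\<beta> i \<bullet> y\<close> or vanishes with it, so all terms are equal and
  \<open>abs_sum v = 1\<close>.\<close>

lemma sign_flat_Int_sign_cone_subset: "sign_flat y \<inter> sign_cone y \<subseteq> sign_face y"
proof
  fix v assume v: "v \<in> sign_flat y \<inter> sign_cone y"
  have "sgn (\<beta> i \<bullet> y) * (\<beta> i \<bullet> v) = \<bar>\<beta> i \<bullet> v\<bar>" if "i \<in> I" for i
  proof (cases "\<beta> i \<bullet> y = 0")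
    case True
    then show ?thesis
      using v that by (auto simp: sign_flat_def)
  next
    case False
    then have "0 < sgn (\<beta> i \<bullet> y) * (\<beta> i \<bullet> v)"
      using v that by (auto simp: sign_cone_def)
    then show ?thesis
      by (auto simp: sgn_if split: if_splits)
  qed
  then have "signed_sum y \<bullet> v = abs_sum v"
    by (simp add: signed_sum_inner_eq_iff)
  then show "v \<in> sign_face y"
    using v by (auto simp: sign_flat_def sign_face_def unit_ball_def)
qed

lemma affine_sign_flat: "affine (sign_flat y)"
  unfolding sign_flat_def by (intro affine_Int affine_Inter) (auto simp: affine_hyperplane)

lemma open_sign_cone: "open (sign_cone y)"
  unfolding sign_cone_def
  using finite_index by (intro open_INT) (auto intro!: open_Collect_less continuous_intros)

lemma mem_sign_flat_Int_sign_cone: "abs_sum y = 1 \<Longrightarrow> y \<in> sign_flat y \<inter> sign_cone y"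
  by (auto simp: sign_flat_def sign_cone_def signed_sum_inner_self sgn_if)

lemma mem_rel_interior_sign_face:
  assumes "abs_sum y = 1"
  shows "y \<in> rel_interior (sign_face y)"
proof -
  have "affine hull sign_face y \<subseteq> sign_flat y"
    by (intro hull_minimal sign_face_subset_sign_flat affine_sign_flat)
  then have "sign_cone y \<inter> affine hull sign_face y \<subseteq> sign_face y"
    using sign_flat_Int_sign_cone_subset by blast
  then show ?thesis
    using open_sign_cone mem_sign_face[OF assms] mem_sign_flat_Int_sign_cone[OF assms]
    by (auto simp: mem_rel_interior)
qed

text \<open>The face lies between the flat and its intersection with the open cone. That
  intersection contains \<open>y\<close>, so it has the full dimension of the flat.\<close>

lemma aff_dim_sign_face:
  assumes "abs_sum y = 1"
  shows "aff_dim (sign_face y) = aff_dim (sign_flat y)"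
proof (rule antisym)
  show "aff_dim (sign_face y) \<le> aff_dim (sign_flat y)"
    by (rule aff_dim_subset[OF sign_face_subset_sign_flat])
  have "aff_dim (sign_flat y) = aff_dim (sign_flat y \<inter> sign_cone y)"
    using mem_sign_flat_Int_sign_cone[OF assms]
    by (intro aff_dim_convex_Int_open[symmetric] affine_imp_convex affine_sign_flat open_sign_cone) auto
  also have "\<dots> \<le> aff_dim (sign_face y)"
    by (rule aff_dim_subset[OF sign_flat_Int_sign_cone_subset])
  finally show "aff_dim (sign_flat y) \<le> aff_dim (sign_face y)" .
qed

section \<open>Dimensions and uniqueness of the faces\<close>

lemma aff_dim_sign_face_le_iff:
  assumes "abs_sum y = 1"
  shows "aff_dim (sign_face y) \<le> int DIM('a) - 2 \<longleftrightarrow> (\<exists>i\<in>I. \<beta> i \<bullet> y = 0)"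
proof (cases "\<exists>i\<in>I. \<beta> i \<bullet> y = 0")
  case True
  then obtain i where i: "i \<in> I" "\<beta> i \<bullet> y = 0"
    by blast
  let ?H = "{v. \<beta> i \<bullet> v = 0}"
  have sub: "sign_flat y \<subseteq> ?H"
    using i by (auto simp: sign_flat_def)
  have "0 \<notin> sign_flat y" "0 \<in> ?H"
    by (auto simp: sign_flat_def)
  then have "sign_flat y \<noteq> ?H"
    by blast
  \<comment> \<open>Nested nonempty affine sets of equal dimension coincide. The strict drop below
    \<open>DIM('a) - 1\<close> gives the bound, as dimensions are integers.\<close>
  then have "aff_dim (sign_flat y) \<noteq> aff_dim ?H"
    using affine_dim_equal[OF affine_sign_flat affine_hyperplane _ sub]
      mem_sign_flat_Int_sign_cone[OF assms] by blast
  then show ?thesis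
    using True aff_dim_subset[OF sub] nonzero[OF i(1)] by (simp add: aff_dim_sign_face[OF assms])
next
  case False
  then have "sign_flat y = {v. signed_sum y \<bullet> v = 1}"
    by (auto simp: sign_flat_def)
  \<comment> \<open>This makes the flat a genuine hyperplane, of dimension
    \<open>DIM('a) - 1\<close>.\<close>
  moreover have "signed_sum y \<noteq> 0"
    using signed_sum_inner_self[of y] assms by auto
  ultimately show ?thesis
    using False by (simp add: aff_dim_sign_face[OF assms])
qed

lemma abs_sum_eq_1_on_face:
  assumes "F face_of unit_ball abs_sum" "F \<noteq> unit_ball abs_sum" "y \<in> F"
  shows "abs_sum y = 1"
proof -
  have "y \<in> unit_ball abs_sum" "y \<notin> interior (unit_ball abs_sum)"
    using assms face_of_imp_subset face_of_disjoint_interior by blast+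
  then show ?thesis
    using abs_sum_less_interior[of y] by (force simp: unit_ball_def)
qed

text \<open>Faces of a convex set whose relative interiors meet are equal; here both contain
  \<open>y\<close>.\<close>

lemma face_eq_sign_face:
  assumes "F face_of unit_ball abs_sum" "y \<in> rel_interior F" "abs_sum y = 1"
  shows "F = sign_face y"
  using assms mem_rel_interior_sign_face
  by (intro face_of_eq[OF assms(1) sign_face_face_of]) blast

end

section \<open>From faces to the skeleton\<close>

lemma mem_skeleton_linear_decomposition:
  assumes "convex P"
  shows "x \<in> skeleton (linear_decomposition P) m \<longleftrightarrow>
    (\<exists>F y. F face_of P \<and> F \<noteq> P \<and> aff_dim F \<le> m \<and> y \<in> rel_interior F \<and> x = radial_proj y)"
proof -
  have dim: "aff_dim (rel_interior F) = aff_dim F" if "F face_of P" for F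
    using that by (intro rel_interior_aff_dim face_of_imp_convex)
  have "x \<in> skeleton (linear_decomposition P) m \<longleftrightarrow>
    (\<exists>F. F face_of P \<and> F \<noteq> {} \<and> F \<noteq> P \<and> aff_dim (rel_interior F) \<le> m \<and>
      x \<in> radial_proj ` rel_interior F)"
    by (auto simp: skeleton_def linear_decomposition_def open_boundary_faces_def)
  also have "\<dots> \<longleftrightarrow>
    (\<exists>F y. F face_of P \<and> F \<noteq> P \<and> aff_dim F \<le> m \<and> y \<in> rel_interior F \<and> x = radial_proj y)"
    \<comment> \<open>The point \<open>y\<close> also witnesses that \<open>F\<close> is
      nonempty.\<close>
    using dim rel_interior_subset by (auto simp: image_iff)
  finally show ?thesis .
qed

theorem proposition5p3:
  fixes \<beta> :: "nat \<Rightarrow> real ^ 'n" and k :: nat and N :: "real ^ 'n \<Rightarrow> real"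
  assumes nonzero: "\<And>i. i \<in> {1..k} \<Longrightarrow> \<beta> i \<noteq> 0"
    and generators: "span (\<beta> ` {1..k}) = UNIV"
    and N_eq: "\<And>v. N v = (\<Sum>i=1..k. \<bar>\<beta> i \<bullet> v\<bar>)"
  shows "has_polyhedral_unit_ball N \<and>
    complete_linear_decomposition (norm_decomposition N) \<and>
    skeleton (norm_decomposition N) (int CARD('n) - 2) =
      sphere 0 1 \<inter> (\<Union>i\<in>{1..k}. {x. \<beta> i \<bullet> x = 0})"
proof -
  interpret generating_family "{1..k}" \<beta>
    by unfold_locales (use nonzero generators in auto)
  have N: "N = abs_sum"
    by (rule ext) (simp only: N_eq abs_sum_def)
  have "0 \<in> interior (unit_ball N)"
    unfolding N by (rule zero_in_interior_unit_ball)
  then have solid: "solid_polyhedron (unit_ball N)"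
    using polyhedron_unit_ball_abs_sum bounded_unit_ball_abs_sum
    by (simp add: N solid_polyhedron_def)
  have dim_le_iff: "aff_dim (sign_face y) \<le> int CARD('n) - 2 \<longleftrightarrow> (\<exists>i\<in>{1..k}. \<beta> i \<bullet> y = 0)"
    if "abs_sum y = 1" for y
    using aff_dim_sign_face_le_iff[OF that] by simp
  have skel: "skeleton (norm_decomposition N) (int CARD('n) - 2) =
      sphere 0 1 \<inter> (\<Union>i\<in>{1..k}. {x. \<beta> i \<bullet> x = 0})" (is "?L = ?R")
  proof (intro equalityI subsetI)
    fix x assume "x \<in> ?L"
    then obtain F y where F: "F face_of unit_ball N" "F \<noteq> unit_ball N"
      "aff_dim F \<le> int CARD('n) - 2" and y: "y \<in> rel_interior F" and x: "x = radial_proj y"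
      using convex_unit_ball_abs_sum
      by (auto simp: N norm_decomposition_def mem_skeleton_linear_decomposition)
    have N1: "abs_sum y = 1"
      using F y rel_interior_subset by (intro abs_sum_eq_1_on_face[of F]) (auto simp: N)
    then have "F = sign_face y"
      using F y by (intro face_eq_sign_face) (auto simp: N)
    then obtain i where "i \<in> {1..k}" "\<beta> i \<bullet> y = 0"
      using F(3) dim_le_iff[OF N1] by blast
    moreover have "y \<noteq> 0"
      using N1 abs_sum_eq_0_iff[of y] by auto
    \<comment> \<open>Radial projection rescales \<open>y\<close>, hence keeps it in each hyperplane
      through the origin.\<close>
    ultimately show "x \<in> ?R"
      by (auto simp: x radial_proj_def)
  next
    fix x assume "x \<in> ?R"
    then obtain i where i: "i \<in> {1..k}" "\<beta> i \<bullet> x = 0" and x: "norm x = 1"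
      by auto
    \<comment> \<open>The point where the ray through \<open>x\<close> leaves the unit ball; its
      radial projection is \<open>x\<close> again.\<close>
    define y where "y = x /\<^sub>R abs_sum x"
    have pos: "0 < abs_sum x"
      using x abs_sum_nonneg[of x] abs_sum_eq_0_iff[of x] by fastforce
    then have N1: "abs_sum y = 1"
      unfolding y_def abs_sum_scaleR by simp
    have "\<beta> i \<bullet> y = 0"
      using i by (simp add: y_def)
    then have "aff_dim (sign_face y) \<le> int CARD('n) - 2"
      using i dim_le_iff[OF N1] by blast
    moreover have "x = radial_proj y"
      using pos x by (simp add: radial_proj_def y_def)
    ultimately show "x \<in> ?L"
      using sign_face_face_of[of y] sign_face_neq_unit_ball[of y] mem_rel_interior_sign_face[OF N1]
        convex_unit_ball_abs_sum
      by (auto simp: N norm_decomposition_def mem_skeleton_linear_decomposition)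
  qed
  have "complete_linear_decomposition (norm_decomposition N)"
    unfolding complete_linear_decomposition_def
  proof
    show "\<exists>P. solid_polyhedron P \<and> norm_decomposition N = linear_decomposition P"
      using solid norm_decomposition_def by blast
    \<comment> \<open>The generators themselves serve as the normals required for
      completeness.\<close>
    have "finite (\<beta> ` {1..k})" "0 \<notin> \<beta> ` {1..k}"
      using nonzero by force+
    then show "\<exists>B. finite B \<and> 0 \<notin> B \<and> skeleton (norm_decomposition N) (int CARD('n) - 2) =
        sphere 0 1 \<inter> (\<Union>b\<in>B. {x. b \<bullet> x = 0})"
      using skel by (intro exI[of _ "\<beta> ` {1..k}"]) simp
  qed
  then show ?thesis
    using solid skel is_norm_abs_sum by (simp add: has_polyhedral_unit_ball_def N)
qed

end
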